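(* For any tree $T$ with $n>2$ vertices, we have $$\frac{n+2}{8} \;\leq\; u(T) \;\leq\; \frac{n-1}{2}.$$
   Context: Graphs are finite and simple. The Toucher-Isolator game on a graph $G=(V(G),E(G))$: two players, Toucher and Isolator, alternately claim previously unclaimed edges of $G$, one edge per move, with Toucher making the first move, until all edges are claimed. A vertex is touched if it is incident to at least one edge claimed by Toucher, and untouched otherwise (i.e. all of its incident edges have been claimed by Isolator). Toucher aims to minimise, and Isolator to maximise, the number of untouched vertices at the end of the game. $u(G)$ denotes the number of untouched vertices at the end of the game when both players play optimally (the minimax value of this game). *)

theory Defs
  imports Complex_Main
begin

text \<open>A finite simple graph is given by its vertex set and its set of edges, an edge being
  the two-element set of its endpoints.\<close>

definition simple_graph :: "'a set \<Rightarrow> 'a set set \<Rightarrow> bool" where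
  "simple_graph V E \<longleftrightarrow> finite V \<and> (\<forall>e\<in>E. e \<subseteq> V \<and> card e = 2)"

definition connected_graph :: "'a set \<Rightarrow> 'a set set \<Rightarrow> bool" where
  "connected_graph V E \<longleftrightarrow> V \<noteq> {} \<and> (\<forall>u\<in>V. \<forall>v\<in>V. (u, v) \<in> {(x, y). {x, y} \<in> E}\<^sup>*)"

text \<open>A cycle is the list of its (at least three) distinct vertices in cyclic order.\<close>

definition is_cycle :: "'a set set \<Rightarrow> 'a list \<Rightarrow> bool" where
  "is_cycle E vs \<longleftrightarrow> 3 \<le> length vs \<and> distinct vs \<and>
     (\<forall>i. Suc i < length vs \<longrightarrow> {vs ! i, vs ! Suc i} \<in> E) \<and> {last vs, hd vs} \<in> E"

definition is_tree :: "'a set \<Rightarrow> 'a set set \<Rightarrow> bool" where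
  "is_tree V E \<longleftrightarrow> simple_graph V E \<and> connected_graph V E \<and> (\<nexists>vs. is_cycle E vs)"

definition untouched :: "'a set \<Rightarrow> 'a set set \<Rightarrow> 'a set" where
  "untouched V A = {v \<in> V. \<forall>e\<in>A. v \<notin> e}"

datatype player = Toucher | Isolator

text \<open>\<open>game_value V p A R\<close> is the minimax number of untouched vertices at the end of the game,
  from the position in which \<open>p\<close> is to move, \<open>A\<close> is the set of edges claimed by Toucher so far
  and \<open>R\<close> is the set of unclaimed edges. The result for infinite \<open>R\<close> is a dummy value that
  keeps the function total.\<close>

function game_value :: "'a set \<Rightarrow> player \<Rightarrow> 'a set set \<Rightarrow> 'a set set \<Rightarrow> nat" where
  "game_value V p A R =
     (if R = {} \<or> infinite R then card (untouched V A)
      else case p of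
        Toucher \<Rightarrow> Min ((\<lambda>e. game_value V Isolator (insert e A) (R - {e})) ` R)
      | Isolator \<Rightarrow> Max ((\<lambda>e. game_value V Toucher A (R - {e})) ` R))"
  by pat_completeness auto
termination
  by (relation "measure (\<lambda>(V, p, A, R). card R)") (auto simp: card_gt_0_iff)

declare game_value.simps [simp del]

definition toucher_isolator_u :: "'a set \<Rightarrow> 'a set set \<Rightarrow> nat" where
  "toucher_isolator_u V E = game_value V Toucher {} E"

end

theory Submission
  imports Defs
begin

text \<open>Let \<open>T\<close> be a tree with \<open>n > 2\<close> vertices, hence \<open>n - 1\<close> edges.

  The upper bound holds however Toucher plays. Toucher claims at least half of the \<open>n - 1\<close>
  edges, and a nonempty forest with \<open>k\<close> edges covers at least \<open>k + 1\<close> vertices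
  (\<open>forest_card_vertices\<close>). So at least \<open>(n + 1) / 2\<close> vertices are touched
  (\<open>game_value_upper_bound\<close>).

  For the lower bound, give an untouched vertex with \<open>r\<close> unclaimed edges the weight
  \<open>2^-r\<close>, and let the potential be the sum of the weights over a set \<open>S\<close> of vertices. At the
  end of the game it counts untouched vertices. The weight of an edge is the sum of the weights of
  its endpoints: when Isolator claims an edge the potential grows by that weight, and when Toucher
  claims it the potential drops by that weight. Isolator plays an edge of maximal weight. Toucher
  can then do better than break even only by answering at an edge that shares a vertex with
  Isolator's, because the weight of that vertex has just doubled. Before the round this vertex
  had two unclaimed edges, so its weight was at most \<open>1/4\<close>, and so is the loss in the round. As
  a round consumes two edges, the potential minus one eighth of the number of unclaimed edges
  never decreases (\<open>game_value_potential_bound\<close>).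

  Take for \<open>S\<close> the vertices of degree at most 2. Since \<open>2^-d \<ge> (3 - d)/4\<close> for
  \<open>d \<le> 2\<close>, \<open>0 \<ge> (3 - d)/4\<close> for \<open>d \<ge> 3\<close>, and the degrees add up to \<open>2(n - 1)\<close>, the initial potential is at least
  \<open>(n + 2)/4\<close> (\<open>tree_potential\<close>). If Toucher opens with an edge of weight at most
  \<open>1/2\<close>, then \<open>n - 2\<close> edges remain and
  \<open>(n + 2)/4 - 1/2 - (n - 2)/8 = (n + 2)/8\<close> vertices stay untouched.
  The only heavier openings join a leaf to a vertex of degree 2 and have weight \<open>3/4\<close>.
  Then another leaf remains, and some edge of maximal weight ends in a leaf. Isolator
  claims such an edge, after which no reply of Toucher makes the potential lower than before
  (\<open>leaf_edge_reply\<close>). This round without loss makes up for the missing \<open>1/4\<close>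
  (\<open>tree_lower_bound\<close>).\<close>

section \<open>Counting edges and vertices\<close>

lemma is_cycle_mono: "is_cycle A vs \<Longrightarrow> A \<subseteq> B \<Longrightarrow> is_cycle B vs"
  unfolding is_cycle_def by blast

lemma simple_graph_finite_edges: "simple_graph V E \<Longrightarrow> finite E"
  unfolding simple_graph_def by (meson Pow_iff finite_Pow_iff finite_subset subsetI)

lemma two_element_edge:
  assumes "card e = 2" "v \<in> e"
  obtains w where "w \<noteq> v" "e = {v, w}"
  using assms by (metis card_2_iff doubleton_eq_iff insertE singletonD)

text \<open>The first vertex of a longest path is a leaf: an edge from it to a new vertex would extend
  the path, and an edge to a later vertex of the path would close a cycle.\<close>

lemma forest_has_leaf:
  assumes fin: "finite A" and edges: "\<forall>e\<in>A. card e = 2" and acyc: "\<nexists>vs. is_cycle A vs"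
    and "A \<noteq> {}"
  shows "\<exists>v\<in>\<Union>A. card {e\<in>A. v \<in> e} = 1"
proof -
  define path where "path vs \<longleftrightarrow> distinct vs \<and> 2 \<le> length vs \<and>
     (\<forall>i. Suc i < length vs \<longrightarrow> {vs ! i, vs ! Suc i} \<in> A)" for vs
  have finU: "finite (\<Union>A)"
    using fin edges by (metis card.infinite finite_Union zero_neq_numeral)
  have bounded: "length vs \<le> card (\<Union>A)" if "path vs" for vs
  proof -
    have "vs ! i \<in> \<Union>A" if i: "i < length vs" for i
    proof (cases i)
      case 0
      with \<open>path vs\<close> have "{vs ! 0, vs ! Suc 0} \<in> A" unfolding path_def by auto
      with 0 show ?thesis by auto
    next
      case (Suc j)
      with \<open>path vs\<close> i have "{vs ! j, vs ! Suc j} \<in> A" unfolding path_def by auto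
      with Suc show ?thesis by auto
    qed
    then have "set vs \<subseteq> \<Union>A" by (auto simp: in_set_conv_nth)
    then have "card (set vs) \<le> card (\<Union>A)" using finU by (rule card_mono[rotated])
    with \<open>path vs\<close> show ?thesis unfolding path_def by (simp add: distinct_card)
  qed
  obtain a b where ab: "{a, b} \<in> A" "a \<noteq> b"
    using \<open>A \<noteq> {}\<close> edges by (metis all_not_in_conv card_2_iff)
  then have "path [a, b]" unfolding path_def by auto
  moreover have "\<forall>vs. path vs \<longrightarrow> length vs < Suc (card (\<Union>A))" using bounded by (simp add: less_Suc_eq_le)
  ultimately have "\<exists>vs. path vs \<and> (\<forall>ws. path ws \<longrightarrow> length ws \<le> length vs)"
    by (rule ex_has_greatest_nat)
  then obtain vs where vs: "path vs" and maxi: "\<And>ws. path ws \<Longrightarrow> length ws \<le> length vs"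
    by metis
  define v where "v = vs ! 0"
  have dist: "distinct vs" and len: "2 \<le> length vs" using vs unfolding path_def by auto
  have first: "{v, vs ! 1} \<in> A" using vs unfolding path_def v_def by auto
  have only: "e = {v, vs ! 1}" if e: "e \<in> A" "v \<in> e" for e
  proof (rule ccontr)
    assume neq: "e \<noteq> {v, vs ! 1}"
    obtain w where w: "w \<noteq> v" "e = {v, w}"
      using two_element_edge e edges by metis
    show False
    proof (cases "w \<in> set vs")
      case False
      have "path (w # vs)"
        unfolding path_def
      proof (intro conjI allI impI)
        show "distinct (w # vs)" using False dist by simp
        show "2 \<le> length (w # vs)" using len by simp
        fix i assume i: "Suc i < length (w # vs)"
        show "{(w # vs) ! i, (w # vs) ! Suc i} \<in> A"
        proof (cases i)
          case 0
          then show ?thesis using w e v_def by (simp add: insert_commute)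
        next
          case (Suc j)
          then show ?thesis using i vs unfolding path_def by simp
        qed
      qed
      from maxi[OF this] show False by simp
    next
      case True
      then obtain i where i: "i < length vs" "vs ! i = w" by (auto simp: in_set_conv_nth)
      have "i \<noteq> 0" using i(2) w(1) v_def by metis
      moreover have "i \<noteq> 1" using i w neq by auto
      ultimately have i2: "2 \<le> i" by linarith
      define c where "c = take (Suc i) vs"
      have lenc: "length c = Suc i" using i unfolding c_def by simp
      have "c \<noteq> []" using lenc by auto
      then have "last c = w" "hd c = v"
        using i lenc by (simp_all add: last_conv_nth hd_conv_nth v_def) (simp_all add: c_def)
      moreover have "{w, v} \<in> A" using e w by (simp add: insert_commute)
      ultimately have "is_cycle A c"
        using i2 lenc dist vs unfolding is_cycle_def path_def by (simp add: c_def)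
      with acyc show False by blast
    qed
  qed
  have "{e\<in>A. v \<in> e} = {{v, vs ! 1}}" using first only by blast
  then have "card {e\<in>A. v \<in> e} = 1" by simp
  moreover have "v \<in> \<Union>A" using first by blast
  ultimately show ?thesis by blast
qed

text \<open>Removing the edge at a leaf also removes the leaf from the covered vertices, which gives
  the induction step. A single edge covers two vertices.\<close>

lemma forest_card_vertices:
  assumes "finite A" "\<forall>e\<in>A. card e = 2" "\<nexists>vs. is_cycle A vs" "A \<noteq> {}"
  shows "card A + 1 \<le> card (\<Union>A)"
  using assms
proof (induction "card A" arbitrary: A rule: less_induct)
  case less
  obtain v where v: "v \<in> \<Union>A" "card {e\<in>A. v \<in> e} = 1"
    using forest_has_leaf less.prems by metis
  then obtain e where e: "{e\<in>A. v \<in> e} = {e}" by (auto simp: card_1_singleton_iff)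
  then have eA: "e \<in> A" "v \<in> e" by auto
  have finU: "finite (\<Union>A)"
    using less.prems by (metis card.infinite finite_Union zero_neq_numeral)
  show ?case
  proof (cases "A = {e}")
    case True
    then show ?thesis using less.prems by simp
  next
    case False
    let ?B = "A - {e}"
    have "card ?B < card A" using eA less.prems(1) by (meson card_Diff1_less)
    moreover have "?B \<noteq> {}" using False eA by auto
    moreover have "\<nexists>vs. is_cycle ?B vs" using less.prems(3) is_cycle_mono by (metis Diff_subset)
    ultimately have "card ?B + 1 \<le> card (\<Union>?B)"
      using less.hyps[of ?B] less.prems by auto
    also have "\<dots> \<le> card (\<Union>A - {v})"
      using e finU by (intro card_mono) auto
    also have "\<dots> = card (\<Union>A) - 1" using v by simp
    finally show ?thesis
      using eA less.prems(1) card_gt_0_iff[of A] by (simp add: card_Diff_singleton)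
  qed
qed

lemma connected_graph_crossing_edge:
  assumes "connected_graph V E" "C \<subseteq> V" "C \<noteq> {}" "C \<noteq> V"
  obtains a b where "a \<in> C" "b \<notin> C" "{a, b} \<in> E"
proof (rule ccontr)
  assume no: "\<not> thesis"
  have closed: "b \<in> C" if "a \<in> C" "{a, b} \<in> E" for a b
    using that no \<open>\<And>a b. \<lbrakk>a \<in> C; b \<notin> C; {a, b} \<in> E\<rbrakk> \<Longrightarrow> thesis\<close> by blast
  obtain u v where "u \<in> C" "v \<in> V" "v \<notin> C" using assms by blast
  then have "(u, v) \<in> {(x, y). {x, y} \<in> E}\<^sup>*"
    using assms unfolding connected_graph_def by blast
  then have "v \<in> C"
    by (induction rule: rtrancl_induct) (use \<open>u \<in> C\<close> closed in auto)
  with \<open>v \<notin> C\<close> show False by simp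
qed

text \<open>Grow a vertex set from a single vertex: each new vertex can be chosen at the end of a
  crossing edge, and that edge is new inside the enlarged set.\<close>

lemma connected_graph_card_edges:
  assumes g: "simple_graph V E" and c: "connected_graph V E"
  shows "card V \<le> card E + 1"
proof -
  have finV: "finite V" using g unfolding simple_graph_def by simp
  have finE: "finite E" using g by (rule simple_graph_finite_edges)
  have "\<exists>C\<subseteq>V. card C = Suc k \<and> Suc k \<le> card {e\<in>E. e \<subseteq> C} + 1" if "Suc k \<le> card V" for k
    using that
  proof (induction k)
    case 0
    obtain v where "v \<in> V" using c unfolding connected_graph_def by blast
    then show ?case by (intro exI[of _ "{v}"]) auto
  next
    case (Suc k)
    then obtain C where C: "C \<subseteq> V" "card C = Suc k" "Suc k \<le> card {e\<in>E. e \<subseteq> C} + 1"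
      by auto
    have "C \<noteq> {}" "C \<noteq> V" using C Suc.prems by auto
    then obtain a b where ab: "a \<in> C" "b \<notin> C" "{a, b} \<in> E"
      using connected_graph_crossing_edge[OF c C(1)] by metis
    have "b \<in> V" using ab g unfolding simple_graph_def by auto
    have "card (insert {a, b} {e\<in>E. e \<subseteq> C}) \<le> card {e\<in>E. e \<subseteq> insert b C}"
      using ab finE by (intro card_mono) auto
    moreover have "card (insert {a, b} {e\<in>E. e \<subseteq> C}) = Suc (card {e\<in>E. e \<subseteq> C})"
      using ab finE by (intro card_insert_disjoint) auto
    moreover have "card (insert b C) = Suc (Suc k)"
      using C ab finV finite_subset by (metis card_insert_disjoint)
    ultimately show ?case
      using C \<open>b \<in> V\<close> by (intro exI[of _ "insert b C"]) auto
  qed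
  from this[of "card V - 1"] obtain C where
    "C \<subseteq> V" "card V \<le> card {e\<in>E. e \<subseteq> C} + 1 \<or> card V = 0" by fastforce
  moreover have "card {e\<in>E. e \<subseteq> C} \<le> card E" using finE by (intro card_mono) auto
  ultimately show ?thesis by linarith
qed

lemma tree_card_edges:
  assumes t: "is_tree V E" and "1 < card V"
  shows "card E + 1 = card V"
proof (rule antisym)
  have g: "simple_graph V E" and c: "connected_graph V E" and a: "\<nexists>vs. is_cycle E vs"
    using t unfolding is_tree_def by auto
  have finV: "finite V" using g unfolding simple_graph_def by simp
  have finE: "finite E" using g by (rule simple_graph_finite_edges)
  show le: "card V \<le> card E + 1" by (rule connected_graph_card_edges[OF g c])
  have "E \<noteq> {}" using le assms(2) by auto
  then have "card E + 1 \<le> card (\<Union>E)"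
    using g a finE by (intro forest_card_vertices) (auto simp: simple_graph_def)
  also have "\<dots> \<le> card V" using g finV by (intro card_mono) (auto simp: simple_graph_def)
  finally show "card E + 1 \<le> card V" .
qed

lemma handshake:
  assumes "simple_graph V E" "finite E"
  shows "(\<Sum>v\<in>V. card {e\<in>E. v \<in> e}) = 2 * card E"
proof -
  have "\<forall>e\<in>E. card {v\<in>V. v \<in> e} = 2"
  proof
    fix e assume "e \<in> E"
    then have "{v\<in>V. v \<in> e} = e" "card e = 2" using assms unfolding simple_graph_def by auto
    then show "card {v\<in>V. v \<in> e} = 2" by simp
  qed
  then have "(\<Sum>v\<in>V. card {e\<in>E. v \<in> e}) = (\<Sum>e\<in>E. 2)"
    using assms unfolding simple_graph_def by (intro sum_multicount_gen) auto
  then show ?thesis by simp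
qed

section \<open>The upper bound\<close>

lemma game_value_end: "game_value V p A {} = card (untouched V A)"
  by (subst game_value.simps) simp

lemma game_value_Toucher:
  "finite R \<Longrightarrow> R \<noteq> {} \<Longrightarrow> game_value V Toucher A R =
     Min ((\<lambda>e. game_value V Isolator (insert e A) (R - {e})) ` R)"
  by (subst game_value.simps) simp

lemma game_value_Isolator:
  "finite R \<Longrightarrow> R \<noteq> {} \<Longrightarrow> game_value V Isolator A R =
     Max ((\<lambda>e. game_value V Toucher A (R - {e})) ` R)"
  by (subst game_value.simps) simp

text \<open>From the given position Toucher will claim half of the unclaimed edges, rounded up if she is
  to move. The hypothesis on \<open>B\<close> is what a forest satisfies; it is applied to the final edge set
  of Toucher, which the last assumption makes nonempty.\<close>

lemma game_value_upper_bound: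
  assumes "finite R" "A \<inter> R = {}" "finite A" "finite V"
    and "\<And>B. B \<subseteq> A \<union> R \<Longrightarrow> B \<noteq> {} \<Longrightarrow> \<Union>B \<subseteq> V \<and> card B + 1 \<le> card (\<Union>B)"
    and "A \<noteq> {} \<or> (p = Toucher \<and> R \<noteq> {})"
  shows "game_value V p A R + card A + (card R + (if p = Toucher then 1 else 0)) div 2 + 1 \<le> card V"
  using assms
proof (induction "card R" arbitrary: R A p rule: less_induct)
  case less
  show ?case
  proof (cases "R = {}")
    case True
    then have "A \<noteq> {}" using less.prems by auto
    then have U: "\<Union>A \<subseteq> V" "card A + 1 \<le> card (\<Union>A)" using less.prems(5)[of A] by auto
    have "untouched V A = V - \<Union>A" by (auto simp: untouched_def)
    then have "card (untouched V A) + card (\<Union>A) = card V"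
      using U less.prems(4) card_mono[OF less.prems(4) U(1)] finite_subset[OF U(1)]
      by (simp add: card_Diff_subset)
    then show ?thesis using U True by (simp add: game_value_end)
  next
    case False
    show ?thesis
    proof (cases p)
      case Toucher
      obtain e where e: "e \<in> R" using False by auto
      have sm: "card (R - {e}) < card R" using e less.prems(1) by (meson card_Diff1_less)
      have "game_value V Isolator (insert e A) (R - {e}) + card (insert e A)
          + (card (R - {e}) + (if Isolator = Toucher then 1 else 0)) div 2 + 1 \<le> card V"
        using e less.prems by (intro less.hyps[OF sm]) (auto intro!: less.prems(5))
      moreover have "card (insert e A) = card A + 1" using e less.prems by (subst card_insert_disjoint) auto
      moreover have "card (R - {e}) + 1 = card R" using card.remove[of R e] e less.prems(1) by linarith
      moreover have "game_value V Toucher A R \<le> game_value V Isolator (insert e A) (R - {e})"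
        using e less.prems(1) False by (subst game_value_Toucher) auto
      ultimately show ?thesis using Toucher by auto
    next
      case Isolator
      have "game_value V Isolator A R \<in> (\<lambda>e. game_value V Toucher A (R - {e})) ` R"
        using less.prems(1) False by (subst game_value_Isolator) auto
      then obtain e where e: "e \<in> R" "game_value V Isolator A R = game_value V Toucher A (R - {e})"
        by auto
      have sm: "card (R - {e}) < card R" using e(1) less.prems(1) by (meson card_Diff1_less)
      have "game_value V Toucher A (R - {e}) + card A
          + (card (R - {e}) + (if Toucher = Toucher then 1 else 0)) div 2 + 1 \<le> card V"
        using e less.prems Isolator by (intro less.hyps[OF sm]) (auto intro!: less.prems(5))
      moreover have "card (R - {e}) + 1 = card R" using card.remove[of R e] e less.prems(1) by linarith
      ultimately show ?thesis using Isolator e by simp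
    qed
  qed
qed

section \<open>The potential of a position\<close>

text \<open>Only the vertices of \<open>S\<close> count. In the tree argument these are the vertices of degree
  at most 2, so that the only openings of weight above \<open>1/2\<close> join two such vertices, at
  least one of them a leaf. Vertices outside \<open>S\<close> get weight 0, so the weight of an edge
  \<open>e\<close> is \<open>sum (weight S A R) e\<close>, wherever the ends of \<open>e\<close> lie.\<close>

definition weight :: "'a set \<Rightarrow> 'a set set \<Rightarrow> 'a set set \<Rightarrow> 'a \<Rightarrow> real" where
  "weight S A R v = (if v \<in> untouched S A then (1 / 2) ^ card {e\<in>R. v \<in> e} else 0)"

definition potential :: "'a set \<Rightarrow> 'a set set \<Rightarrow> 'a set set \<Rightarrow> real" where
  "potential S A R = (\<Sum>v\<in>S. weight S A R v)"

lemma weight_nonneg: "0 \<le> weight S A R v"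
  by (simp add: weight_def)

lemma weight_le_of_free_degree:
  assumes "k \<le> card {e\<in>R. v \<in> e}"
  shows "weight S A R v \<le> (1 / 2) ^ k"
  using assms by (auto simp: weight_def intro!: power_decreasing)

lemma weight_Isolator_move:
  assumes "finite R" "e \<in> R"
  shows "weight S A (R - {e}) v = (if v \<in> e then 2 else 1) * weight S A R v"
proof (cases "v \<in> e")
  case True
  let ?D = "{f\<in>R. v \<in> f}"
  have "{f\<in>R - {e}. v \<in> f} = ?D - {e}" by auto
  moreover have "card ?D = Suc (card (?D - {e}))"
    using assms True by (subst card_Suc_Diff1) auto
  ultimately show ?thesis using True by (simp add: weight_def)
next
  case False
  then have "{f\<in>R - {e}. v \<in> f} = {f\<in>R. v \<in> f}" by auto
  then show ?thesis using False by (simp add: weight_def)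
qed

lemma weight_Toucher_move:
  "weight S (insert f A) (R - {f}) v = (if v \<in> f then 0 else weight S A R v)"
proof (cases "v \<in> f")
  case False
  then have "{e\<in>R - {f}. v \<in> e} = {e\<in>R. v \<in> e}" by auto
  then show ?thesis using False by (simp add: weight_def untouched_def)
qed (simp add: weight_def untouched_def)

lemma sum_weight_Int:
  assumes "finite S" "finite e"
  shows "(\<Sum>v\<in>S. if v \<in> e then weight S A R v else 0) = sum (weight S A R) e"
proof -
  have "(\<Sum>v\<in>S. if v \<in> e then weight S A R v else 0) = sum (weight S A R) (S \<inter> e)"
    using assms by (simp add: sum.inter_restrict)
  also have "\<dots> = sum (weight S A R) e"
    using assms by (intro sum.mono_neutral_left) (auto simp: weight_def untouched_def)
  finally show ?thesis .
qed

lemma potential_Isolator_move: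
  assumes "finite S" "finite R" "e \<in> R" "finite e"
  shows "potential S A (R - {e}) = potential S A R + sum (weight S A R) e"
proof -
  have "potential S A (R - {e})
      = (\<Sum>v\<in>S. weight S A R v + (if v \<in> e then weight S A R v else 0))"
    unfolding potential_def using assms by (intro sum.cong) (auto simp: weight_Isolator_move)
  then show ?thesis using assms by (simp add: sum.distrib potential_def sum_weight_Int)
qed

lemma potential_Toucher_move:
  assumes "finite S" "finite f"
  shows "potential S (insert f A) (R - {f}) = potential S A R - sum (weight S A R) f"
proof -
  have "potential S (insert f A) (R - {f})
      = (\<Sum>v\<in>S. weight S A R v - (if v \<in> f then weight S A R v else 0))"
    unfolding potential_def by (intro sum.cong) (auto simp: weight_Toucher_move)
  then show ?thesis using assms by (simp add: sum_subtractf potential_def sum_weight_Int)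
qed

text \<open>The last term is the advantage of answering next to Isolator's edge: Toucher destroys the
  weight of a common vertex after it has doubled.\<close>

lemma potential_round:
  assumes "finite S" "finite R" "e \<in> R" "finite e" "finite f"
  shows "potential S (insert f A) (R - {e} - {f})
    = potential S A R + sum (weight S A R) e - sum (weight S A R) f - sum (weight S A R) (e \<inter> f)"
proof -
  have "sum (weight S A (R - {e})) f
      = (\<Sum>v\<in>f. weight S A R v + (if v \<in> e then weight S A R v else 0))"
    using assms by (intro sum.cong) (auto simp: weight_Isolator_move)
  also have "\<dots> = sum (weight S A R) f + sum (weight S A R) (f \<inter> e)"
    using assms by (simp add: sum.distrib sum.inter_restrict)
  finally show ?thesis
    using assms potential_Toucher_move[of S f A "R - {e}"] potential_Isolator_move[of S R e A]
    by (simp add: Int_commute)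
qed

lemma potential_end_le:
  assumes "finite V" "S \<subseteq> V"
  shows "potential S A {} \<le> card (untouched V A)"
proof -
  have fS: "finite S" using assms finite_subset by blast
  have "potential S A {} = (\<Sum>v\<in>S. if v \<in> untouched S A then 1 else 0)"
    unfolding potential_def weight_def by (intro sum.cong) auto
  also have "\<dots> = card (S \<inter> untouched S A)"
    using fS by (simp flip: sum.inter_restrict)
  also have "card (S \<inter> untouched S A) \<le> card (untouched V A)"
    using assms by (intro card_mono) (auto simp: untouched_def)
  finally show ?thesis by simp
qed

section \<open>Greedy play of Isolator\<close>

lemma finite_maximizer:
  fixes g :: "'b \<Rightarrow> real"
  assumes "finite R" "R \<noteq> {}"
  shows "\<exists>m\<in>R. \<forall>h\<in>R. g h \<le> g m"
proof -
  have "Max (g ` R) \<in> g ` R" using assms by (intro Max_in) auto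
  then obtain m where "Max (g ` R) = g m" "m \<in> R" by (rule imageE)
  moreover have "g h \<le> Max (g ` R)" if "h \<in> R" for h using assms(1) that by (intro Max_ge) auto
  ultimately show ?thesis by (metis (no_types))
qed

text \<open>One round of the game seen from Isolator, who fixes the move \<open>e\<close>. The first case is that
  \<open>e\<close> was the last edge, so that Toucher has no reply.\<close>

lemma Isolator_move_lower_bound:
  fixes b :: real
  assumes "finite R" "e \<in> R"
    and "R - {e} = {} \<Longrightarrow> b \<le> card (untouched V A)"
    and "\<And>f. f \<in> R - {e} \<Longrightarrow> b \<le> game_value V Isolator (insert f A) (R - {e} - {f})"
  shows "b \<le> game_value V Isolator A R"
proof -
  have "b \<le> game_value V Toucher A (R - {e})"
  proof (cases "R - {e} = {}")
    case True
    then show ?thesis using assms(3) by (metis game_value_end)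
  next
    case False
    have "game_value V Toucher A (R - {e})
        \<in> (\<lambda>f. game_value V Isolator (insert f A) (R - {e} - {f})) ` (R - {e})"
      using False assms(1) by (subst game_value_Toucher) auto
    then obtain f where "f \<in> R - {e}"
      "game_value V Toucher A (R - {e}) = game_value V Isolator (insert f A) (R - {e} - {f})"
      by (rule imageE)
    then show ?thesis using assms(4) by presburger
  qed
  also have "game_value V Toucher A (R - {e}) \<le> game_value V Isolator A R"
    using assms(1,2) by (subst game_value_Isolator) auto
  finally show ?thesis by simp
qed

text \<open>A common vertex of two unclaimed edges has at least two unclaimed edges.\<close>

lemma shared_weight_le:
  assumes "finite R" "e \<in> R" "f \<in> R" "e \<noteq> f" "card e = 2" "card f = 2"
  shows "sum (weight S A R) (e \<inter> f) \<le> 1 / 4"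
proof (cases "e \<inter> f = {}")
  case False
  then obtain v where v: "v \<in> e" "v \<in> f" by auto
  then have ef: "e \<inter> f = {v}" using assms by (auto elim!: two_element_edge)
  have "card {e, f} \<le> card {g\<in>R. v \<in> g}" using assms v by (intro card_mono) auto
  then have "weight S A R v \<le> (1 / 2) ^ 2"
    using assms by (intro weight_le_of_free_degree) auto
  then show ?thesis using ef by (simp add: power2_eq_square)
qed simp

text \<open>Isolator always claims an edge of maximal weight. A full round costs at most \<open>1/4\<close> of
  potential and uses up two edges, so the rate of one eighth per edge pays for it.\<close>

lemma game_value_potential_bound:
  assumes "finite V" "S \<subseteq> V" "finite R" "\<forall>e\<in>R. card e = 2"
  shows "potential S A R - card R / 8 \<le> game_value V Isolator A R"
  using assms(3,4)
proof (induction "card R" arbitrary: A R rule: less_induct)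
  case less
  have finS: "finite S" using assms finite_subset by blast
  show ?case
  proof (cases "R = {}")
    case True
    then show ?thesis using potential_end_le[OF assms(1,2)] by (simp add: game_value_end)
  next
    case False
    let ?W = "sum (weight S A R)"
    obtain e where eR: "e \<in> R" and greedy: "\<And>f. f \<in> R \<Longrightarrow> ?W f \<le> ?W e"
      using finite_maximizer[OF less.prems(1) False, of ?W] by blast
    have fin2: "finite f" if "f \<in> R" for f
      using that less.prems by (metis card.infinite zero_neq_numeral)
    show ?thesis
    proof (rule Isolator_move_lower_bound[OF less.prems(1) eR])
      assume last: "R - {e} = {}"
      have "0 \<le> ?W e" by (intro sum_nonneg weight_nonneg)
      then have "potential S A R \<le> potential S A {}"
        using potential_Isolator_move[OF finS less.prems(1) eR fin2[OF eR], of A] last by simp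
      then show "potential S A R - card R / 8 \<le> card (untouched V A)"
        using potential_end_le[OF assms(1,2), of A] by simp
    next
      fix f assume f: "f \<in> R - {e}"
      let ?R = "R - {e} - {f}"
      have card: "card R = card ?R + 2"
        using card.remove[OF less.prems(1) eR] card.remove[OF _ f] less.prems(1) by simp
      have "potential S A R - 1 / 4 \<le> potential S (insert f A) ?R"
      proof -
        have "f \<in> R" "e \<noteq> f" using f by auto
        then show ?thesis
          using potential_round[OF finS less.prems(1) eR fin2 fin2, of f A] eR less.prems(2)
            greedy[of f] shared_weight_le[OF less.prems(1) eR, of f S A]
          by simp
      qed
      moreover have "potential S (insert f A) ?R - card ?R / 8
          \<le> game_value V Isolator (insert f A) ?R"
        using less.prems card by (intro less.hyps) auto
      moreover have "real (card R) = card ?R + 2" using card by simp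
      ultimately show "potential S A R - card R / 8 \<le> game_value V Isolator (insert f A) ?R"
        by linarith
    qed
  qed
qed

section \<open>The opening move in a tree\<close>

lemma connected_graph_degree_pos:
  assumes "simple_graph V E" "finite E" "connected_graph V E" "1 < card V" "v \<in> V"
  shows "1 \<le> card {e\<in>E. v \<in> e}"
proof -
  have "{v} \<noteq> V" using assms by auto
  then obtain b where "{v, b} \<in> E"
    using connected_graph_crossing_edge[OF assms(3), of "{v}"] assms(5)
    by (metis empty_not_insert empty_subsetI insert_subset singletonD)
  then have "{e\<in>E. v \<in> e} \<noteq> {}" by auto
  then show ?thesis using assms by (simp add: Suc_le_eq card_gt_0_iff)
qed

text \<open>The linear function \<open>(3 - d)/4\<close> agrees with \<open>2^-d\<close> at \<open>d = 1\<close> and \<open>d = 2\<close>,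
  lies below it at \<open>d = 0\<close>, and is at most 0 from \<open>d = 3\<close> on, where the vertices have weight 0. Its sum over a
  tree depends only on the number of vertices.\<close>

lemma tree_potential:
  assumes "is_tree V E" "1 < card V"
  shows "(real (card V) + 2) / 4 \<le> potential {v\<in>V. card {e\<in>E. v \<in> e} \<le> 2} {} E"
proof -
  let ?d = "\<lambda>v. card {e\<in>E. v \<in> e}" and ?S = "{v\<in>V. card {e\<in>E. v \<in> e} \<le> 2}"
  have g: "simple_graph V E" and finV: "finite V"
    using assms unfolding is_tree_def simple_graph_def by auto
  have finE: "finite E" using g by (rule simple_graph_finite_edges)
  have "real (\<Sum>v\<in>V. ?d v) + 2 = 2 * card V"
    using handshake[OF g finE] tree_card_edges[OF assms] by simp
  then have "(real (card V) + 2) / 4 = (\<Sum>v\<in>V. (3 - real (?d v)) / 4)"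
    by (simp add: sum_subtractf flip: sum_divide_distrib)
  also have "\<dots> \<le> (\<Sum>v\<in>V. if ?d v \<le> 2 then weight ?S {} E v else 0)"
  proof (rule sum_mono)
    fix v assume "v \<in> V"
    show "(3 - real (?d v)) / 4 \<le> (if ?d v \<le> 2 then weight ?S {} E v else 0)"
    proof (cases "?d v \<le> 2")
      case True
      then have "?d v = 0 \<or> ?d v = 1 \<or> ?d v = 2" by linarith
      then have "(3 - real (?d v)) / 4 \<le> (1 / 2) ^ ?d v"
        by (elim disjE) (simp_all add: power2_eq_square)
      then show ?thesis using True \<open>v \<in> V\<close> by (simp add: weight_def untouched_def)
    qed simp
  qed
  also have "\<dots> = potential ?S {} E"
    unfolding potential_def using finV by (simp add: sum.If_cases Int_def)
  finally show ?thesis .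
qed

text \<open>Otherwise the degrees would add up to at least \<open>1 + 2(n - 1)\<close>.\<close>

lemma tree_other_leaf:
  assumes "is_tree V E" "1 < card V" "x \<in> V"
  shows "\<exists>x'\<in>V. x' \<noteq> x \<and> card {e\<in>E. x' \<in> e} = 1"
proof (rule ccontr)
  let ?d = "\<lambda>v. card {e\<in>E. v \<in> e}"
  assume no: "\<not> (\<exists>x'\<in>V. x' \<noteq> x \<and> ?d x' = 1)"
  have g: "simple_graph V E" and c: "connected_graph V E" and finV: "finite V"
    using assms unfolding is_tree_def simple_graph_def by auto
  have finE: "finite E" using g by (rule simple_graph_finite_edges)
  note pos = connected_graph_degree_pos[OF g finE c assms(2)]
  have "2 \<le> ?d v" if "v \<in> V - {x}" for v
  proof -
    have v: "v \<in> V" "v \<noteq> x" using that by auto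
    then have "?d v \<noteq> 1" using no by blast
    moreover have "1 \<le> ?d v" using v(1) by (rule pos)
    ultimately show ?thesis by linarith
  qed
  then have "(\<Sum>v\<in>V - {x}. 2) \<le> (\<Sum>v\<in>V - {x}. ?d v)" by (rule sum_mono)
  moreover have "(\<Sum>v\<in>V. ?d v) = ?d x + (\<Sum>v\<in>V - {x}. ?d v)"
    using finV assms(3) by (rule sum.remove)
  moreover have "card V = Suc (card (V - {x}))" using finV assms(3) by (rule card.remove)
  moreover have "(\<Sum>v\<in>V - {x}. 2) = 2 * card (V - {x})" by simp
  ultimately show False
    using pos[OF assms(3)] handshake[OF g finE] tree_card_edges[OF assms(1,2)] by linarith
qed

lemma weight_gt_quarter:
  assumes "finite R" "1 / 4 < weight S A R v" "e \<in> R" "v \<in> e"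
  shows "v \<in> untouched S A" "{g\<in>R. v \<in> g} = {e}" "weight S A R v = 1 / 2"
proof -
  have "\<not> 2 \<le> card {g\<in>R. v \<in> g}"
  proof
    assume "2 \<le> card {g\<in>R. v \<in> g}"
    then have "weight S A R v \<le> (1 / 2) ^ 2" by (rule weight_le_of_free_degree)
    with assms(2) show False by (simp add: power2_eq_square)
  qed
  moreover have mem: "e \<in> {g\<in>R. v \<in> g}" using assms(3,4) by simp
  then have "0 < card {g\<in>R. v \<in> g}" using assms(1) by (intro card_gt_0_iff[THEN iffD2]) auto
  ultimately have one: "card {g\<in>R. v \<in> g} = 1" by linarith
  then obtain e' where e': "{g\<in>R. v \<in> g} = {e'}" by (rule card_1_singletonE)
  with mem have "e = e'" by (metis singletonD)
  with e' show "{g\<in>R. v \<in> g} = {e}" by metis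
  show "v \<in> untouched S A" using assms(2) by (auto simp: weight_def split: if_splits)
  then show "weight S A R v = 1 / 2" using one by (simp add: weight_def)
qed

text \<open>After Toucher's opening \<open>f\<close>, Isolator claims an edge \<open>e = {u, v}\<close> of maximal weight at
  a vertex \<open>u\<close> with no other unclaimed edge. A reply disjoint from \<open>e\<close> is no heavier than
  \<open>e\<close>. Any other reply is an edge \<open>h = {v, z}\<close>, and it destroys \<open>2 w(v) + w(z)\<close> against the
  gain \<open>1/2 + w(v)\<close>. The reply is therefore harmless if \<open>w(v) + w(z) \<le> 1/2\<close>. As
  \<open>w(v) \<le> 1/4\<close>, this fails only if \<open>u\<close> and \<open>z\<close> are leaves and \<open>v\<close> is an
  untouched vertex of degree 2. Then \<open>u, v, z\<close> form a component that \<open>f\<close> does not meet,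
  which is impossible in a connected graph.\<close>

lemma leaf_edge_reply:
  assumes g: "simple_graph V E" and c: "connected_graph V E"
    and SV: "S \<subseteq> V" "\<And>v. v \<in> S \<Longrightarrow> card {e\<in>E. v \<in> e} \<le> 2"
    and f: "f \<in> E" and e: "e \<in> E - {f}" "u \<in> e" "weight S {f} (E - {f}) u = 1 / 2"
      "{h\<in>E - {f}. u \<in> h} = {e}"
    and heavy: "\<And>h. h \<in> E - {f} \<Longrightarrow> sum (weight S {f} (E - {f})) h \<le> sum (weight S {f} (E - {f})) e"
    and h: "h \<in> E - {f} - {e}"
  shows "sum (weight S {f} (E - {f})) h + sum (weight S {f} (E - {f})) (e \<inter> h)
     \<le> sum (weight S {f} (E - {f})) e"
proof (cases "e \<inter> h = {}")
  case True
  then show ?thesis using heavy[of h] h by simp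
next
  case False
  let ?R = "E - {f}" and ?w = "weight S {f} (E - {f})"
  have edge: "card e = 2" "card h = 2" "card f = 2" and finV: "finite V"
    using g e h f unfolding simple_graph_def by auto
  have finE: "finite E" using g by (rule simple_graph_finite_edges)
  have "u \<notin> h" using e(4) h by auto
  obtain v where v: "v \<noteq> u" "e = {u, v}" using two_element_edge[OF edge(1) e(2)] by metis
  with False \<open>u \<notin> h\<close> have "v \<in> h" by auto
  obtain z where z: "z \<noteq> v" "h = {v, z}" using two_element_edge[OF edge(2) \<open>v \<in> h\<close>] by metis
  have "z \<noteq> u" using z \<open>u \<notin> h\<close> by auto
  have "e \<inter> h = {v}" using v z \<open>z \<noteq> u\<close> by auto
  have "v \<in> e" "e \<noteq> h" using v h by auto
  then have hv: "{e, h} \<subseteq> {k\<in>?R. v \<in> k}" "card {e, h} = 2"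
    using e(1) h \<open>v \<in> h\<close> by simp_all
  have "card {e, h} \<le> card {k\<in>?R. v \<in> k}" using finE hv by (intro card_mono) auto
  then have wv: "?w v \<le> 1 / 4"
    using weight_le_of_free_degree[of 2 ?R v S "{f}"] hv by (simp add: power2_eq_square)
  have "?w v + ?w z \<le> 1 / 2"
  proof (cases "?w v = 0 \<or> ?w z \<le> 1 / 4")
    case True
    have "card {h} \<le> card {k\<in>?R. z \<in> k}" using finE h z by (intro card_mono) auto
    then have "?w z \<le> 1 / 2"
      using weight_le_of_free_degree[of 1 ?R z S "{f}"] by simp
    with True wv show ?thesis by auto
  next
    case False
    have un: "u \<in> untouched S {f}" "v \<in> untouched S {f}"
      using e(3) False by (auto simp: weight_def split: if_splits)
    have zz: "z \<in> untouched S {f}" "{k\<in>?R. z \<in> k} = {h}"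
      using weight_gt_quarter[of ?R S "{f}" z h] False finE h z by auto
    have vv: "{k\<in>E. v \<in> k} = {e, h}"
    proof (rule card_seteq[symmetric])
      show "finite {k\<in>E. v \<in> k}" using finE by simp
      show "{e, h} \<subseteq> {k\<in>E. v \<in> k}" using hv by auto
      show "card {k\<in>E. v \<in> k} \<le> card {e, h}" using SV(2)[of v] un hv by (auto simp: untouched_def)
    qed
    have "{u, v, z} \<noteq> V"
    proof
      assume "{u, v, z} = V"
      then have "f \<subseteq> {u, v, z}" using g f unfolding simple_graph_def by auto
      then have "f = {}" using un zz by (auto simp: untouched_def)
      then show False using edge by simp
    qed
    moreover have "{u, v, z} \<subseteq> V" using un zz SV by (auto simp: untouched_def)
    ultimately obtain a b where ab: "a \<in> {u, v, z}" "b \<notin> {u, v, z}" "{a, b} \<in> E"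
      using connected_graph_crossing_edge[OF c, of "{u, v, z}"] by blast
    have "{a, b} \<noteq> f" using ab un zz by (auto simp: untouched_def)
    then have "{a, b} \<in> ?R" using ab by blast
    then have "{a, b} = e \<or> {a, b} = h"
      using ab(1) ab(3) eqset_imp_iff[OF e(4), of "{a, b}"] eqset_imp_iff[OF zz(2), of "{a, b}"]
        eqset_imp_iff[OF vv, of "{a, b}"] by auto
    then have "b \<in> {u, v} \<union> {v, z}" using v(2) z(2) by blast
    then show ?thesis using ab(2) by blast
  qed
  then show ?thesis
    using v z \<open>e \<inter> h = {v}\<close> \<open>z \<noteq> u\<close> e(3) by simp
qed

text \<open>The bound after each opening \<open>f\<close> of Toucher. An opening of weight above \<open>1/2\<close> must
  touch a leaf \<open>x\<close>. Its other end \<open>y\<close> is not a leaf, as the tree has more than two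
  vertices, so the opening costs at most \<open>3/4\<close> and leaves another leaf \<open>x'\<close> for
  Isolator to use.\<close>

lemma tree_lower_bound:
  assumes t: "is_tree V E" and n: "2 < card V" and f: "f \<in> E"
  shows "(real (card V) + 2) / 8 \<le> game_value V Isolator {f} (E - {f})"
proof -
  define S where "S = {v\<in>V. card {e\<in>E. v \<in> e} \<le> 2}"
  let ?R = "E - {f}"
  let ?wt = "weight S {} E" and ?w = "weight S {f} ?R"
  have g: "simple_graph V E" and c: "connected_graph V E" and finV: "finite V"
    using t unfolding is_tree_def simple_graph_def by auto
  have finE: "finite E" using g by (rule simple_graph_finite_edges)
  have SV: "S \<subseteq> V" unfolding S_def by auto
  then have finS: "finite S" using finV by (rule finite_subset)
  have edge: "card e = 2" "finite e" "e \<subseteq> V" if "e \<in> E" for e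
    using g that finite_subset[OF _ finV, of e] unfolding simple_graph_def by auto
  have "card E + 1 = card V" using t n by (intro tree_card_edges) auto
  moreover have "card E = Suc (card ?R)" using finE f by (rule card.remove)
  ultimately have cardR: "real (card ?R) = real (card V) - 2" using n by simp
  have P0: "(real (card V) + 2) / 4 \<le> potential S {} E"
    unfolding S_def using t n by (intro tree_potential) auto
  have P1: "potential S {f} ?R = potential S {} E - sum ?wt f"
    using potential_Toucher_move[OF finS edge(2)[OF f], of "{}" E] by simp
  have w_eq: "?w v = ?wt v" if "v \<notin> f" for v
    using weight_Toucher_move[of S f "{}" E v] that by simp
  show ?thesis
  proof (cases "sum ?wt f \<le> 1 / 2")
    case True
    have "potential S {f} ?R - card ?R / 8 \<le> game_value V Isolator {f} ?R"
      using finV SV finE edge by (intro game_value_potential_bound) auto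
    then show ?thesis using True P0 P1 cardR by argo
  next
    case False
    have heavy_end: "\<exists>u\<in>h. 1 / 4 < weight S A Q u"
      if h: "1 / 2 < sum (weight S A Q) h" "card h = 2" for A Q h
    proof -
      obtain a b where "h = {a, b}" "a \<noteq> b" using h(2) by (auto simp: card_2_iff)
      then show ?thesis using h(1) by (cases "1 / 4 < weight S A Q a") auto
    qed
    obtain x where x: "x \<in> f" "1 / 4 < ?wt x"
      using heavy_end[of "{}" E f] False edge(1)[OF f] by auto
    note x_leaf = weight_gt_quarter[OF finE x(2) f x(1)]
    obtain y where y: "y \<noteq> x" "f = {x, y}" using two_element_edge[OF edge(1)[OF f] x(1)] by metis
    have wy: "?wt y \<le> 1 / 4"
    proof (rule ccontr)
      assume "\<not> ?wt y \<le> 1 / 4"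
      then have "1 / 4 < ?wt y" by simp
      then have y_leaf: "{h\<in>E. y \<in> h} = {f}"
        by (rule weight_gt_quarter(2)[OF finE _ f]) (simp add: y)
      have "card f \<noteq> card V" using edge(1)[OF f] n by simp
      then have "f \<noteq> V" by auto
      then obtain a b where ab: "a \<in> f" "b \<notin> f" "{a, b} \<in> E"
        using connected_graph_crossing_edge[OF c edge(3)[OF f]] y by blast
      from ab(1) y have "a = x \<or> a = y" by blast
      then have "{a, b} \<in> {h\<in>E. x \<in> h} \<or> {a, b} \<in> {h\<in>E. y \<in> h}" using ab(3) by auto
      then have "{a, b} = f" unfolding x_leaf(2) y_leaf by simp
      then show False using ab by auto
    qed
    have sum_f: "sum ?wt f = 1 / 2 + ?wt y" using y x_leaf(3) by simp
    have "x \<in> V" using f x edge(3) by auto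
    then obtain x' where x': "x' \<in> V" "x' \<noteq> x" "card {h\<in>E. x' \<in> h} = 1"
      using tree_other_leaf[OF t, of x] n by auto
    have "x' \<in> S" using x' unfolding S_def by simp
    then have w0x': "?wt x' = 1 / 2" using x' by (simp add: weight_def untouched_def)
    have "x' \<notin> f" using x' y wy w0x' by auto
    then have wx': "?w x' = 1 / 2" using w_eq w0x' by simp
    obtain e' where e': "{h\<in>E. x' \<in> h} = {e'}" using x'(3) by (rule card_1_singletonE)
    then have "e' \<in> {h\<in>E. x' \<in> h}" by (metis singletonI)
    then have e'R: "e' \<in> ?R" "x' \<in> e'" using \<open>x' \<notin> f\<close> by auto
    have We': "1 / 2 \<le> sum ?w e'"
    proof -
      have "?w x' \<le> sum ?w e'"
        by (rule member_le_sum) (use e'R edge(2) in \<open>auto simp: weight_nonneg\<close>)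
      then show ?thesis using wx' by simp
    qed
    \<comment> \<open>A maximal edge of weight above \<open>1/2\<close> has a leaf as an end; otherwise the edge at \<open>x'\<close>
      is itself maximal.\<close>
    obtain e u where e: "e \<in> ?R" "u \<in> e" "1 / 4 < ?w u" and heavy: "\<And>h. h \<in> ?R \<Longrightarrow> sum ?w h \<le> sum ?w e"
    proof -
      have "finite ?R" "?R \<noteq> {}" using finE e'R by auto
      then obtain m where m: "m \<in> ?R" and mx: "\<And>h. h \<in> ?R \<Longrightarrow> sum ?w h \<le> sum ?w m"
        using finite_maximizer[of ?R "sum ?w"] by blast
      show thesis
      proof (cases "1 / 2 < sum ?w m")
        case True
        then obtain u where "u \<in> m" "1 / 4 < ?w u" using heavy_end[of "{f}" ?R m] m edge(1) by auto
        then show thesis using that m mx by blast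
      next
        case False
        then have "sum ?w h \<le> sum ?w e'" if "h \<in> ?R" for h using mx[OF that] We' by simp
        moreover have "1 / 4 < ?w x'" using wx' by simp
        ultimately show thesis using that e'R by blast
      qed
    qed
    have finR: "finite ?R" using finE by simp
    note u_leaf = weight_gt_quarter[OF finR e(3,1,2)]
    have We: "1 / 2 \<le> sum ?w e" using heavy[OF e'R(1)] We' by simp
    have low: "(real (card V) + 2) / 4 - 3 / 4 \<le> potential S {f} ?R" using P0 P1 sum_f wy by argo
    show ?thesis
    proof (rule Isolator_move_lower_bound[OF finR e(1)])
      assume last: "?R - {e} = {}"
      have "potential S {f} ?R + sum ?w e = potential S {f} (?R - {e})"
        using potential_Isolator_move[OF finS finR e(1) edge(2)] e(1) by simp
      also have "\<dots> \<le> card (untouched V {f})"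
        unfolding last by (rule potential_end_le[OF finV SV])
      finally show "(real (card V) + 2) / 8 \<le> card (untouched V {f})" 
        using low We of_nat_0_le_iff[where ?'a = real, of "card V"] by argo
    next
      fix h assume h: "h \<in> ?R - {e}"
      let ?Q = "?R - {e} - {h}"
      have "card ?R = Suc (card (?R - {e}))" using finR e(1) by (rule card.remove)
      moreover have "card (?R - {e}) = Suc (card ?Q)" using finR h by (intro card.remove) auto
      ultimately have cardQ: "real (card ?Q) = real (card V) - 4" using cardR n by linarith
      have "sum ?w h + sum ?w (e \<inter> h) \<le> sum ?w e"
      proof (rule leaf_edge_reply[OF g c SV _ f e(1,2) u_leaf(3,2) heavy h])
        show "card {k\<in>E. v \<in> k} \<le> 2" if "v \<in> S" for v using that unfolding S_def by simp
      qed
      then have "potential S {f} ?R \<le> potential S (insert h {f}) ?Q"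
        using potential_round[OF finS finR e(1) edge(2) edge(2), of h "{f}"] e(1) h by auto
      moreover have "potential S (insert h {f}) ?Q - card ?Q / 8
          \<le> game_value V Isolator (insert h {f}) ?Q"
        using finV SV finE edge by (intro game_value_potential_bound) auto
      ultimately show "(real (card V) + 2) / 8 \<le> game_value V Isolator (insert h {f}) ?Q"
        using low cardQ by argo
    qed
  qed
qed

theorem theorem1p6:
  fixes V :: "'a set" and E :: "'a set set"
  assumes "is_tree V E"
    and "card V > 2"
  shows "(real (card V) + 2) / 8 \<le> real (toucher_isolator_u V E)
    \<and> real (toucher_isolator_u V E) \<le> (real (card V) - 1) / 2"
proof
  have g: "simple_graph V E" and acyc: "\<nexists>vs. is_cycle E vs" and finV: "finite V"
    using assms unfolding is_tree_def simple_graph_def by auto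
  have finE: "finite E" using g by (rule simple_graph_finite_edges)
  have cardE: "card E + 1 = card V" using assms by (intro tree_card_edges) auto
  then have "E \<noteq> {}" using assms(2) by auto
  have "game_value V Toucher {} E \<in> (\<lambda>f. game_value V Isolator {f} (E - {f})) ` E"
    using finE \<open>E \<noteq> {}\<close> by (subst game_value_Toucher) auto
  then obtain f where "f \<in> E" "game_value V Toucher {} E = game_value V Isolator {f} (E - {f})"
    by (rule imageE)
  then show "(real (card V) + 2) / 8 \<le> real (toucher_isolator_u V E)"
    using tree_lower_bound[OF assms, of f] by (simp add: toucher_isolator_u_def)
  have "\<Union>B \<subseteq> V \<and> card B + 1 \<le> card (\<Union>B)" if B: "B \<subseteq> {} \<union> E" "B \<noteq> {}" for B
  proof
    have edges: "e \<subseteq> V \<and> card e = 2" if "e \<in> B" for e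
      using B that g unfolding simple_graph_def by auto
    then show "\<Union>B \<subseteq> V" by auto
    show "card B + 1 \<le> card (\<Union>B)"
    proof (rule forest_card_vertices)
      show "finite B" using B finE finite_subset by auto
      show "\<nexists>vs. is_cycle B vs" using acyc B is_cycle_mono by (metis Un_empty_left)
    qed (use edges B in auto)
  qed
  then have "game_value V Toucher {} E + card ({} :: 'a set set)
      + (card E + (if Toucher = Toucher then 1 else 0)) div 2 + 1 \<le> card V"
    using finE finV \<open>E \<noteq> {}\<close> by (intro game_value_upper_bound) auto
  then have "2 * game_value V Toucher {} E + 1 \<le> card V" using cardE by simp
  then have "real (2 * game_value V Toucher {} E + 1) \<le> real (card V)" by (rule of_nat_mono)
  then show "real (toucher_isolator_u V E) \<le> (real (card V) - 1) / 2"
    by (simp add: toucher_isolator_u_def)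
qed

end
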